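(* Let $\Theta=\{\theta_1<\dots<\theta_K\}\subset\mathbb{R}_+$ and let $\mu\in\Delta(\Theta)$ with full support. If $\sigma\in\Sigma^\star(\mu)$, then $\sigma$ is implementable through price-based regulation.
   Context: Setting. $\Theta=\{\theta_1<\dots<\theta_K\}\subset\mathbb{R}_+$ is a finite set (buyer types) and $P=\Theta$ (prices). $\Delta(X)$ is the set of probability distributions on a finite set $X$. The market $\mu\in\Delta(\Theta)$ satisfies $\mu(\theta)>0$ for all $\theta\in\Theta$. Segmentations. $\Sigma(\mu)$ is the set of $\sigma\in\Delta(\Theta\times P)$ such that $\sum_{p\in P}\sigma(\theta,p)=\mu(\theta)$ for all $\theta\in\Theta$ and (obedience) for all $p,q\in P$, $p\sum_{\theta\ge p}\sigma(\theta,p)\ge q\sum_{\theta\ge q}\sigma(\theta,p)$. Let $\Omega=\{(\theta,p)\in\Theta\times P:\theta\ge p\}$ and $\Sigma^\star(\mu)=\{\sigma\in\Sigma(\mu):\operatorname{supp}(\sigma)\subseteq\Omega\}$. The price distribution of $\sigma$ is $\sigma_P(p)=\sum_{\theta\in\Theta}\sigma(\theta,p)$. Implementability. For $\sigma\in\Sigma(\mu)$ let $\mathcal{D}_\mu(\sigma)=\{\sigma'\in\Sigma(\mu):\sigma'_P=\sigma_P\}$. A segmentation $\sigma\in\Sigma(\mu)$ is implementable through price-based regulation if there exists no $\sigma'\in\mathcal{D}_\mu(\sigma)$ such that $\sum_{p\in\operatorname{supp}(\sigma'_P)}p\sum_{\theta\ge p}\sigma'(\theta,p)>\sum_{p\in\operatorname{supp}(\sigma_P)}p\sum_{\theta\ge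 p}\sigma(\theta,p)$. *)

theory Defs
  imports "HOL-Probability.Probability_Mass_Function"
begin

text \<open>
  \<open>\<Theta>\<close> is the finite set of buyer types. The set of prices \<open>P\<close> is equal to \<open>\<Theta>\<close>, so
  only \<open>\<Theta>\<close> appears as a parameter below. In a pair \<open>(\<theta>, p)\<close> the first component is the type,
  the second the price.
\<close>

definition distributions :: "'a set \<Rightarrow> 'a pmf set" where
  "distributions X = {\<nu>. set_pmf \<nu> \<subseteq> X}"

definition segmentations :: "real set \<Rightarrow> real pmf \<Rightarrow> (real \<times> real) pmf set" where
  "segmentations \<Theta> \<mu> = {\<sigma> \<in> distributions (\<Theta> \<times> \<Theta>).
     (\<forall>\<theta>\<in>\<Theta>. (\<Sum>p\<in>\<Theta>. pmf \<sigma> (\<theta>, p)) = pmf \<mu> \<theta>) \<and>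
     (\<forall>p\<in>\<Theta>. \<forall>q\<in>\<Theta>.
        p * (\<Sum>\<theta> | \<theta> \<in> \<Theta> \<and> \<theta> \<ge> p. pmf \<sigma> (\<theta>, p))
          \<ge> q * (\<Sum>\<theta> | \<theta> \<in> \<Theta> \<and> \<theta> \<ge> q. pmf \<sigma> (\<theta>, p)))}"

definition trade_region :: "real set \<Rightarrow> (real \<times> real) set" where
  "trade_region \<Theta> = {(\<theta>, p) \<in> \<Theta> \<times> \<Theta>. \<theta> \<ge> p}"

definition star_segmentations :: "real set \<Rightarrow> real pmf \<Rightarrow> (real \<times> real) pmf set" where
  "star_segmentations \<Theta> \<mu> = {\<sigma> \<in> segmentations \<Theta> \<mu>. set_pmf \<sigma> \<subseteq> trade_region \<Theta>}"

definition price_distribution :: "(real \<times> real) pmf \<Rightarrow> real pmf" where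
  "price_distribution \<sigma> = map_pmf snd \<sigma>"

lemma pmf_price_distribution:
  assumes "finite \<Theta>" and "\<sigma> \<in> distributions (\<Theta> \<times> \<Theta>)"
  shows "pmf (price_distribution \<sigma>) p = (\<Sum>\<theta>\<in>\<Theta>. pmf \<sigma> (\<theta>, p))"
proof -
  have "pmf (price_distribution \<sigma>) p = measure (measure_pmf \<sigma>) (snd -` {p})"
    by (simp add: price_distribution_def pmf_map)
  also have "\<dots> = measure (measure_pmf \<sigma>) (snd -` {p} \<inter> set_pmf \<sigma>)"
    by (rule measure_Int_set_pmf[symmetric])
  also have "snd -` {p} \<inter> set_pmf \<sigma> = (\<lambda>\<theta>. (\<theta>, p)) ` \<Theta> \<inter> set_pmf \<sigma>"
    using assms(2) by (auto simp: distributions_def)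
  also have "measure (measure_pmf \<sigma>) \<dots> = measure (measure_pmf \<sigma>) ((\<lambda>\<theta>. (\<theta>, p)) ` \<Theta>)"
    by (rule measure_Int_set_pmf)
  also have "\<dots> = (\<Sum>x\<in>(\<lambda>\<theta>. (\<theta>, p)) ` \<Theta>. pmf \<sigma> x)"
    using assms(1) by (simp add: measure_measure_pmf_finite)
  also have "\<dots> = (\<Sum>\<theta>\<in>\<Theta>. pmf \<sigma> (\<theta>, p))"
    by (simp add: sum.reindex inj_on_def)
  finally show ?thesis .
qed

definition same_price_segmentations ::
  "real set \<Rightarrow> real pmf \<Rightarrow> (real \<times> real) pmf \<Rightarrow> (real \<times> real) pmf set" where
  "same_price_segmentations \<Theta> \<mu> \<sigma> =
     {\<sigma>' \<in> segmentations \<Theta> \<mu>. price_distribution \<sigma>' = price_distribution \<sigma>}"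

definition producer_surplus :: "real set \<Rightarrow> (real \<times> real) pmf \<Rightarrow> real" where
  "producer_surplus \<Theta> \<sigma> =
     (\<Sum>p\<in>set_pmf (price_distribution \<sigma>). p * (\<Sum>\<theta> | \<theta> \<in> \<Theta> \<and> \<theta> \<ge> p. pmf \<sigma> (\<theta>, p)))"

definition price_implementable :: "real set \<Rightarrow> real pmf \<Rightarrow> (real \<times> real) pmf \<Rightarrow> bool" where
  "price_implementable \<Theta> \<mu> \<sigma> \<longleftrightarrow> \<sigma> \<in> segmentations \<Theta> \<mu> \<and>
     \<not> (\<exists>\<sigma>' \<in> same_price_segmentations \<Theta> \<mu> \<sigma>.
           producer_surplus \<Theta> \<sigma>' > producer_surplus \<Theta> \<sigma>)"

end

theory Submission
  imports Defs
begin

text \<open>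
  At price \<open>p\<close> the producer earns at most \<open>p\<close> from each unit of mass, so producer surplus is at
  most the mean of the price distribution. Equality holds when every buyer trades, that is, when the
  support lies in \<open>trade_region \<Theta>\<close>; and the mean price is the same for all segmentations that share
  a price distribution.
\<close>

text \<open>Summing over the support, as in \<open>producer_surplus\<close>, lets the two quantities
  be compared price by price.\<close>

definition mean_price :: "(real \<times> real) pmf \<Rightarrow> real" where
  "mean_price \<sigma> = (\<Sum>p\<in>set_pmf (price_distribution \<sigma>). p * pmf (price_distribution \<sigma>) p)"

lemma set_price_distribution_subset:
  assumes "\<sigma> \<in> distributions (\<Theta> \<times> \<Theta>)"
  shows "set_pmf (price_distribution \<sigma>) \<subseteq> \<Theta>"
  using assms by (auto simp: distributions_def price_distribution_def)

lemma producer_surplus_le_mean_price: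
  assumes "finite \<Theta>" and "\<Theta> \<subseteq> {0..}" and "\<sigma> \<in> distributions (\<Theta> \<times> \<Theta>)"
  shows "producer_surplus \<Theta> \<sigma> \<le> mean_price \<sigma>"
  \<comment> \<open>With the marginal written as a sum over all types, the two sides differ at each
    price \<open>p\<close> only by the mass of types below \<open>p\<close>.\<close>
  unfolding producer_surplus_def mean_price_def pmf_price_distribution[OF assms(1,3)]
proof (intro sum_mono mult_left_mono)
  fix p assume "p \<in> set_pmf (price_distribution \<sigma>)"
  \<comment> \<open>The sign of \<open>p\<close> matters: multiplying by a negative price would
    reverse the comparison of masses.\<close>
  then show "0 \<le> p"
    using set_price_distribution_subset[OF assms(3)] assms(2) by auto
  show "(\<Sum>\<theta> | \<theta> \<in> \<Theta> \<and> \<theta> \<ge> p. pmf \<sigma> (\<theta>, p)) \<le> (\<Sum>\<theta>\<in>\<Theta>. pmf \<sigma> (\<theta>, p))"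
    using assms(1) by (intro sum_mono2) auto
qed

text \<open>A pair with \<theta> < p lies outside the support, so restricting the inner sum to
  \<theta> \<ge> p discards only zeros.\<close>

lemma producer_surplus_eq_mean_price:
  assumes "finite \<Theta>" and "\<sigma> \<in> distributions (\<Theta> \<times> \<Theta>)" and "set_pmf \<sigma> \<subseteq> trade_region \<Theta>"
  shows "producer_surplus \<Theta> \<sigma> = mean_price \<sigma>"
proof -
  have "(\<Sum>\<theta> | \<theta> \<in> \<Theta> \<and> \<theta> \<ge> p. pmf \<sigma> (\<theta>, p)) = (\<Sum>\<theta>\<in>\<Theta>. pmf \<sigma> (\<theta>, p))" for p
    using assms(1,3)
    by (intro sum.mono_neutral_left) (auto simp: trade_region_def pmf_eq_0_set_pmf)
  then show ?thesis
    by (simp add: producer_surplus_def mean_price_def pmf_price_distribution[OF assms(1,2)])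
qed

theorem proposition4:
  fixes \<Theta> :: "real set" and \<mu> :: "real pmf" and \<sigma> :: "(real \<times> real) pmf"
  assumes "finite \<Theta>" and "\<Theta> \<subseteq> {0..}"
    and "\<mu> \<in> distributions \<Theta>" and "\<forall>\<theta>\<in>\<Theta>. pmf \<mu> \<theta> > 0"
    and "\<sigma> \<in> star_segmentations \<Theta> \<mu>"
  shows "price_implementable \<Theta> \<mu> \<sigma>"
proof -
  have \<sigma>: "\<sigma> \<in> segmentations \<Theta> \<mu>" "\<sigma> \<in> distributions (\<Theta> \<times> \<Theta>)" "set_pmf \<sigma> \<subseteq> trade_region \<Theta>"
    using assms(5) by (auto simp: star_segmentations_def segmentations_def)
  \<comment> \<open>The competitor \<open>\<sigma>'\<close> may put mass on types that do not trade,
    so it gets only the upper bound; equality is applied to \<open>\<sigma>\<close> alone.\<close>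
  have "producer_surplus \<Theta> \<sigma>' \<le> producer_surplus \<Theta> \<sigma>"
    if "\<sigma>' \<in> same_price_segmentations \<Theta> \<mu> \<sigma>" for \<sigma>'
  proof -
    have "\<sigma>' \<in> distributions (\<Theta> \<times> \<Theta>)" and same: "price_distribution \<sigma>' = price_distribution \<sigma>"
      using that by (auto simp: same_price_segmentations_def segmentations_def)
    then have "producer_surplus \<Theta> \<sigma>' \<le> mean_price \<sigma>'"
      using producer_surplus_le_mean_price assms(1,2) by blast
    also have "\<dots> = mean_price \<sigma>"
      by (simp add: mean_price_def same)
    also have "\<dots> = producer_surplus \<Theta> \<sigma>"
      using producer_surplus_eq_mean_price[OF assms(1) \<sigma>(2,3)] by simp
    finally show ?thesis .
  qed
  then show ?thesis
    using \<sigma>(1) by (force simp: price_implementable_def)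
qed

end
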